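(* Let $(H,H_+)$ be a non-trivial subgroup of $(\mathbb Q,\mathbb Q_+)$ and let $X$ be a non-empty totally ordered set on which $H$ acts by order automorphisms, $(h,x)\mapsto h+x$, such that $h+x>x$ for all $x\in X$ and all $h\in H_+$, $h\ne0$, and such that for all $x,y\in X$ there exists $h\in H_+$ with $h+x>y$. Then the formula $$F(\underline n)=\mathrm{Hom}_{\mathfrak g}(\mathfrak g(n),G(X,H))$$ defines a flat functor $F:\tilde\Lambda^{\rm op}\to\mathrm{Sets}$.
   Context: Oriented groupoids. An oriented groupoid $(G,G_+)$ is a groupoid $G$ (small category with all morphisms invertible, identified with its set of morphisms, with set of units $G^{(0)}$, range $r$, source $s$) with a subcategory $G_+\subset G$ such that $G_+\cap G_+^{-1}=G^{(0)}$ and $G_+\cup G_+^{-1}=G$. A morphism of oriented groupoids is a functor mapping $G_+$ into $G'_+$. $\mathrm{Hom}_{\mathfrak g}(G,G')$ denotes the set of non-trivial morphisms of oriented groupoids, i.e. those not sending every element to a unit. $G(X,H)$ is the quotient of $X\times X$ by the diagonal action of $H$, with units $X/H$, $r(x,y)=x$, $s(x,y)=y$ (mod $H$), $(x,y)\circ(y,z)=(x,z)$, and $G_+(X,H)=\{(x,y): x\ge y\}$. For $m\ge0$, $\mathfrak g(m)=(\mathbb Z/(m+1)\mathbb Z)\ltimes\mathbb Z$ is the oriented groupoid with elements $(a,h)$, $s(a,h)=a$, $r(a,h)=a+h$, $(a,h)\circ(a',h')=(a',h+h')$ when $a=a'+h'$, and $\mathfrak g(m)_+=\{h\ge0\}$.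 It is canonically isomorphic to the quotient of $\mathbb Z\times\mathbb Z$ by diagonal translation by multiples of $m+1$ (oriented by $x\ge y$), via $(x,y)\mapsto(y \bmod (m+1),\,x-y)$. Epicyclic category. $\tilde\Lambda$ has objects $\underline n=(\mathbb Z,x\mapsto x+n+1)$, $n\ge0$; $\mathrm{Hom}_{\tilde\Lambda}(\underline n,\underline m)$ is the set of classes of non-decreasing maps $f:\mathbb Z\to\mathbb Z$ with $f(x+n+1)=f(x)+k(m+1)$ for some integer $k>0$, modulo $f\sim f+a(m+1)$, $a\in\mathbb Z$. It is identified with the category with objects $\mathfrak g(n)$ and morphisms the non-trivial morphisms of oriented groupoids, by letting $f$ act as $(x,y)\mapsto(f(x),f(y))$; $F$ acts on morphisms by precomposition. A functor $F:\mathcal C\to\mathrm{Sets}$ on a small category is flat iff its category of elements $\int_{\mathcal C}F$ is filtering: it is non-empty; for any two objects $i,j$ there are an object $k$ and morphisms $k\to i$, $k\to j$; for any $\alpha,\beta:i\to j$ there is $\gamma:k\to i$ with $\alpha\gamma=\beta\gamma$. (Here objects of $\int_{\mathcal C}F$ are pairs $(c,x)$, $x\in F(c)$, and morphisms $(c,x)\to(d,y)$ are $\gamma\in \mathrm{Hom}_{\mathcal C}(c,d)$ with $F(\gamma)x=y$.) *)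

theory Defs
  imports Complex_Main "HOL-Library.FuncSet"
begin

section \<open>Oriented groupoids\<close>

text \<open>
  A groupoid is identified with its set of morphisms, and a unit with the corresponding identity
  morphism, so that source and range are themselves elements of the groupoid. The product
  \<open>Mul G a b\<close> stands for \<open>a \<circ> b\<close> and is meaningful when \<open>Src G a = Rng G b\<close>.
\<close>

record 'a ogrpd =
  Arr :: "'a set"
  Src :: "'a \<Rightarrow> 'a"
  Rng :: "'a \<Rightarrow> 'a"
  Mul :: "'a \<Rightarrow> 'a \<Rightarrow> 'a"
  Pos :: "'a set"

definition Units :: "'a ogrpd \<Rightarrow> 'a set" where
  "Units G = Src G ` Arr G"

definition inverses :: "'a ogrpd \<Rightarrow> 'a set \<Rightarrow> 'a set" where
  "inverses G P = {b \<in> Arr G. \<exists>a\<in>P. Src G a = Rng G b \<and> Src G b = Rng G a \<and>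
                     Mul G a b = Rng G a \<and> Mul G b a = Src G a}"

locale oriented_groupoid =
  fixes G :: "'a ogrpd"
  assumes src_closed: "a \<in> Arr G \<Longrightarrow> Src G a \<in> Arr G"
    and rng_closed: "a \<in> Arr G \<Longrightarrow> Rng G a \<in> Arr G"
    and src_src: "a \<in> Arr G \<Longrightarrow> Src G (Src G a) = Src G a"
    and rng_src: "a \<in> Arr G \<Longrightarrow> Rng G (Src G a) = Src G a"
    and src_rng: "a \<in> Arr G \<Longrightarrow> Src G (Rng G a) = Rng G a"
    and rng_rng: "a \<in> Arr G \<Longrightarrow> Rng G (Rng G a) = Rng G a"
    and mul_closed: "\<lbrakk>a \<in> Arr G; b \<in> Arr G; Src G a = Rng G b\<rbrakk> \<Longrightarrow> Mul G a b \<in> Arr G"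
    and src_mul: "\<lbrakk>a \<in> Arr G; b \<in> Arr G; Src G a = Rng G b\<rbrakk> \<Longrightarrow> Src G (Mul G a b) = Src G b"
    and rng_mul: "\<lbrakk>a \<in> Arr G; b \<in> Arr G; Src G a = Rng G b\<rbrakk> \<Longrightarrow> Rng G (Mul G a b) = Rng G a"
    and mul_assoc: "\<lbrakk>a \<in> Arr G; b \<in> Arr G; c \<in> Arr G; Src G a = Rng G b; Src G b = Rng G c\<rbrakk>
                      \<Longrightarrow> Mul G (Mul G a b) c = Mul G a (Mul G b c)"
    and mul_unit_left: "a \<in> Arr G \<Longrightarrow> Mul G (Rng G a) a = a"
    and mul_unit_right: "a \<in> Arr G \<Longrightarrow> Mul G a (Src G a) = a"
    and invertible: "a \<in> Arr G \<Longrightarrow> inverses G {a} \<noteq> {}"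
    and pos_subset: "Pos G \<subseteq> Arr G"
    and pos_mul: "\<lbrakk>a \<in> Pos G; b \<in> Pos G; Src G a = Rng G b\<rbrakk> \<Longrightarrow> Mul G a b \<in> Pos G"
    and pos_Int_inverses: "Pos G \<inter> inverses G (Pos G) = Units G"
    and pos_Un_inverses: "Pos G \<union> inverses G (Pos G) = Arr G"

text \<open>
  Morphisms are extensional functions on the set of elements (value \<open>undefined\<close> elsewhere), so that
  equality in \<open>Hom_g G G'\<close> is equality of morphisms. Since units are the identity morphisms,
  preservation of source and range includes preservation of identities.
\<close>

definition og_morphism :: "'a ogrpd \<Rightarrow> 'b ogrpd \<Rightarrow> ('a \<Rightarrow> 'b) \<Rightarrow> bool" where
  "og_morphism G G' f \<longleftrightarrow>
     f \<in> Arr G \<rightarrow>\<^sub>E Arr G' \<and>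
     (\<forall>a\<in>Arr G. f (Src G a) = Src G' (f a) \<and> f (Rng G a) = Rng G' (f a)) \<and>
     (\<forall>a\<in>Arr G. \<forall>b\<in>Arr G. Src G a = Rng G b \<longrightarrow> f (Mul G a b) = Mul G' (f a) (f b)) \<and>
     f ` Pos G \<subseteq> Pos G'"

definition Hom_g :: "'a ogrpd \<Rightarrow> 'b ogrpd \<Rightarrow> ('a \<Rightarrow> 'b) set" where
  "Hom_g G G' = {f. og_morphism G G' f \<and> \<not> (\<forall>a\<in>Arr G. f a \<in> Units G')}"


section \<open>The groupoid \<open>G(X,H)\<close>\<close>

locale rat_order_action =
  fixes H :: "rat set" and X :: "'x::linorder set" and act :: "rat \<Rightarrow> 'x \<Rightarrow> 'x"
  assumes H_zero: "0 \<in> H"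
    and H_add: "\<lbrakk>h \<in> H; k \<in> H\<rbrakk> \<Longrightarrow> h + k \<in> H"
    and H_uminus: "h \<in> H \<Longrightarrow> - h \<in> H"
    and act_bij: "h \<in> H \<Longrightarrow> bij_betw (act h) X X"
    and act_strict_mono: "h \<in> H \<Longrightarrow> strict_mono_on X (act h)"
    and act_zero: "x \<in> X \<Longrightarrow> act 0 x = x"
    and act_add: "\<lbrakk>h \<in> H; k \<in> H; x \<in> X\<rbrakk> \<Longrightarrow> act (h + k) x = act h (act k x)"

definition diag_rel ::
    "rat set \<Rightarrow> 'x set \<Rightarrow> (rat \<Rightarrow> 'x \<Rightarrow> 'x) \<Rightarrow> (('x \<times> 'x) \<times> ('x \<times> 'x)) set" where
  "diag_rel H X act = {((x, y), (x', y')). x \<in> X \<and> y \<in> X \<and> (\<exists>h\<in>H. x' = act h x \<and> y' = act h y)}"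

text \<open>
  The elements are the orbits, i.e. subsets of \<open>X \<times> X\<close>. An element \<open>x\<close> of \<open>X/H\<close> is identified with the
  unit given by the orbit of \<open>(x,x)\<close>. The product of the orbits of \<open>(x,y)\<close> and \<open>(y,z)\<close> is their
  composite as relations; by freeness of the action it is the orbit of \<open>(x,z)\<close>, see
  \<open>orbit_mul\<close> below.
\<close>

definition GXH :: "'x::linorder set \<Rightarrow> rat set \<Rightarrow> (rat \<Rightarrow> 'x \<Rightarrow> 'x) \<Rightarrow> ('x \<times> 'x) set ogrpd" where
  "GXH X H act =
     \<lparr> Arr = (X \<times> X) // diag_rel H X act,
       Src = (\<lambda>\<alpha>. (\<lambda>(x, y). (y, y)) ` \<alpha>),
       Rng = (\<lambda>\<alpha>. (\<lambda>(x, y). (x, x)) ` \<alpha>),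
       Mul = (\<lambda>\<alpha> \<beta>. \<alpha> O \<beta>),
       Pos = {diag_rel H X act `` {(x, y)} | x y. x \<in> X \<and> y \<in> X \<and> x \<ge> y} \<rparr>"

locale free_rat_order_action = rat_order_action +
  assumes act_gt: "\<lbrakk>h \<in> H; h > 0; x \<in> X\<rbrakk> \<Longrightarrow> act h x > x"
begin

definition orb :: "'a \<Rightarrow> 'a \<Rightarrow> ('a \<times> 'a) set" where
  "orb x y = {(act h x, act h y) | h. h \<in> H}"

lemma act_closed: "h \<in> H \<Longrightarrow> x \<in> X \<Longrightarrow> act h x \<in> X"
  using act_bij[of h] by (auto simp: bij_betw_def)

lemma act_minus: "h \<in> H \<Longrightarrow> x \<in> X \<Longrightarrow> act (- h) (act h x) = x"
  using act_add[of "- h" h x] act_zero[of x] H_uminus[of h] by simp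

lemma act_eq: assumes "h \<in> H" "k \<in> H" "x \<in> X" "act h x = act k x" shows "h = k"
proof -
  have "h' \<le> k'" if "h' \<in> H" "k' \<in> H" "act h' x = act k' x" for h' k'
  proof (rule ccontr)
    assume "\<not> h' \<le> k'"
    moreover have m: "h' - k' \<in> H" using H_add[of h' "- k'"] H_uminus[of k'] that by simp
    ultimately have "act (h' - k') (act k' x) > act k' x"
      using act_gt act_closed[OF that(2) assms(3)] by simp
    moreover have "act (h' - k') (act k' x) = act h' x"
      using act_add[OF m that(2) assms(3)] by simp
    ultimately show False using that(3) by simp
  qed
  from this[OF assms(1,2,4)] this[OF assms(2,1) assms(4)[symmetric]] show ?thesis by simp
qed

lemma orbit_eq_orb: "x \<in> X \<Longrightarrow> y \<in> X \<Longrightarrow> diag_rel H X act `` {(x, y)} = orb x y"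
  by (auto simp: diag_rel_def orb_def)

lemma arr_eq: "Arr (GXH X H act) = {orb x y | x y. x \<in> X \<and> y \<in> X}"
proof -
  have "Arr (GXH X H act) = (\<lambda>(x, y). diag_rel H X act `` {(x, y)}) ` (X \<times> X)"
    by (auto simp: GXH_def quotient_def)
  also have "\<dots> = (\<lambda>(x, y). orb x y) ` (X \<times> X)"
    by (rule image_cong[OF refl]) (use orbit_eq_orb in \<open>auto simp del: Image_singleton_iff\<close>)
  finally show ?thesis by auto
qed

lemma pos_eq: "Pos (GXH X H act) = {orb x y | x y. x \<in> X \<and> y \<in> X \<and> x \<ge> y}"
proof -
  have "Pos (GXH X H act) = (\<lambda>(x, y). diag_rel H X act `` {(x, y)}) ` {(x, y). x \<in> X \<and> y \<in> X \<and> x \<ge> y}"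
    by (auto simp: GXH_def)
  also have "\<dots> = (\<lambda>(x, y). orb x y) ` {(x, y). x \<in> X \<and> y \<in> X \<and> x \<ge> y}"
    by (rule image_cong[OF refl]) (use orbit_eq_orb in \<open>auto simp del: Image_singleton_iff\<close>)
  finally show ?thesis by auto
qed

lemma orb_mem: "x \<in> X \<Longrightarrow> y \<in> X \<Longrightarrow> (x, y) \<in> orb x y"
  using act_zero H_zero unfolding orb_def by (intro CollectI exI[of _ 0]) simp

lemma orb_act: assumes "h \<in> H" "x \<in> X" "y \<in> X" shows "orb (act h x) (act h y) = orb x y"
proof
  show "orb (act h x) (act h y) \<subseteq> orb x y"
  proof
    fix p assume "p \<in> orb (act h x) (act h y)"
    then obtain k where k: "k \<in> H" "p = (act k (act h x), act k (act h y))" by (auto simp: orb_def)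
    then have "p = (act (k + h) x, act (k + h) y)" using assms act_add by simp
    then show "p \<in> orb x y" using H_add[OF k(1) assms(1)] by (auto simp: orb_def)
  qed
  show "orb x y \<subseteq> orb (act h x) (act h y)"
  proof
    fix p assume "p \<in> orb x y"
    then obtain k where k: "k \<in> H" "p = (act k x, act k y)" by (auto simp: orb_def)
    have m: "k - h \<in> H" using H_add[of k "- h"] H_uminus[of h] k assms by simp
    have "p = (act (k - h) (act h x), act (k - h) (act h y))"
      using k act_add[OF m assms(1)] assms by simp
    then show "p \<in> orb (act h x) (act h y)" using m by (auto simp: orb_def)
  qed
qed

lemma orb_eqD: "orb x y = orb u v \<Longrightarrow> x \<in> X \<Longrightarrow> y \<in> X \<Longrightarrow> \<exists>h\<in>H. x = act h u \<and> y = act h v"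
  using orb_mem[of x y] by (auto simp: orb_def)

lemma orbit_src: "Src (GXH X H act) (orb x y) = orb y y"
  by (auto simp: GXH_def orb_def image_iff)

lemma orbit_rng: "Rng (GXH X H act) (orb x y) = orb x x"
  by (auto simp: GXH_def orb_def image_iff)

lemma orbit_mul:
  assumes "x \<in> X" "y \<in> X" "z \<in> X" shows "Mul (GXH X H act) (orb x y) (orb y z) = orb x z"
proof -
  have "orb x y O orb y z = orb x z"
  proof
    show "orb x y O orb y z \<subseteq> orb x z"
    proof
      fix p assume "p \<in> orb x y O orb y z"
      then obtain h k where hk: "h \<in> H" "k \<in> H" "act h y = act k y" "p = (act h x, act k z)"
        by (auto simp: orb_def)
      then have "h = k" using act_eq assms by blast
      then show "p \<in> orb x z" using hk by (auto simp: orb_def)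
    qed
    show "orb x z \<subseteq> orb x y O orb y z" by (auto simp: orb_def)
  qed
  then show ?thesis by (simp add: GXH_def)
qed

lemma unit_eq: "Units (GXH X H act) = {orb x x | x. x \<in> X}"
  unfolding Units_def arr_eq using orbit_src by (auto simp: image_iff)

lemma composableE:
  assumes "a \<in> Arr (GXH X H act)" "b \<in> Arr (GXH X H act)"
    "Src (GXH X H act) a = Rng (GXH X H act) b"
  obtains x y z where "x \<in> X" "y \<in> X" "z \<in> X" "a = orb x y" "b = orb y z"
proof -
  obtain x y u v where *: "x \<in> X" "y \<in> X" "u \<in> X" "v \<in> X" "a = orb x y" "b = orb u v"
    using assms arr_eq by auto
  then have "orb y y = orb u u" using assms(3) orbit_src orbit_rng by simp
  then obtain h where "h \<in> H" "y = act h u" using orb_eqD * by blast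
  then show thesis using that[of x y "act h v"] * orb_act act_closed by simp
qed

lemma orbit_pos_iff: assumes "x \<in> X" "y \<in> X" shows "orb x y \<in> Pos (GXH X H act) \<longleftrightarrow> x \<ge> y"
proof
  assume "orb x y \<in> Pos (GXH X H act)"
  then obtain u v where uv: "u \<in> X" "v \<in> X" "u \<ge> v" "orb x y = orb u v" by (auto simp: pos_eq)
  then obtain h where "h \<in> H" "x = act h u" "y = act h v" using orb_eqD assms by blast
  then show "x \<ge> y" using uv act_strict_mono[of h]
    by (metis order_le_less strict_mono_onD)
qed (use assms pos_eq in blast)

lemma inverses_singleton:
  assumes "x \<in> X" "y \<in> X" shows "inverses (GXH X H act) {orb x y} = {orb y x}"
proof
  show "{orb y x} \<subseteq> inverses (GXH X H act) {orb x y}"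
    using assms by (auto simp: inverses_def orbit_src orbit_rng orbit_mul arr_eq)
  show "inverses (GXH X H act) {orb x y} \<subseteq> {orb y x}"
  proof
    fix b assume "b \<in> inverses (GXH X H act) {orb x y}"
    then have b: "b \<in> Arr (GXH X H act)" "orb y y = Rng (GXH X H act) b"
      "Mul (GXH X H act) (orb x y) b = orb x x"
      by (auto simp: inverses_def orbit_src orbit_rng)
    obtain u v where uv: "u \<in> X" "v \<in> X" "b = orb u v" using b arr_eq by auto
    then obtain h where h: "h \<in> H" "y = act h u" using b(2) orbit_rng orb_eqD assms by metis
    define z where "z = act h v"
    have z: "z \<in> X" "b = orb y z" using uv h orb_act act_closed z_def by auto
    then have "orb x z = orb x x" using b(3) orbit_mul assms by simp
    then obtain k where k: "k \<in> H" "x = act k x" "z = act k x" using orb_eqD assms z by blast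
    then show "b \<in> {orb y x}" using z by simp
  qed
qed

lemma inverses_Un: "inverses G P = (\<Union>a\<in>P. inverses G {a})"
  by (auto simp: inverses_def)

lemma inverses_pos: "inverses (GXH X H act) (Pos (GXH X H act))
    = {orb x y | x y. x \<in> X \<and> y \<in> X \<and> x \<le> y}"
proof -
  have "inverses (GXH X H act) (Pos (GXH X H act))
      = (\<Union>a\<in>{orb x y | x y. x \<in> X \<and> y \<in> X \<and> x \<ge> y}. inverses (GXH X H act) {a})"
    using inverses_Un[of "GXH X H act" "Pos (GXH X H act)"] unfolding pos_eq .
  also have "\<dots> = {orb x y | x y. x \<in> X \<and> y \<in> X \<and> x \<le> y}"
  proof (intro equalityI subsetI, goal_cases)
    case (1 b)
    then obtain x y where "x \<in> X" "y \<in> X" "x \<ge> y" "b \<in> inverses (GXH X H act) {orb x y}" by blast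
    then have "x \<in> X" "y \<in> X" "y \<le> x" "b = orb y x" using inverses_singleton by auto
    then show ?case by blast
  next
    case (2 b)
    then obtain x y where "x \<in> X" "y \<in> X" "x \<le> y" "b = orb x y" by blast
    then have "b \<in> inverses (GXH X H act) {orb y x}" "orb y x \<in> {orb x y | x y. x \<in> X \<and> y \<in> X \<and> x \<ge> y}"
      using inverses_singleton by auto
    then show ?case by blast
  qed
  finally show ?thesis .
qed

lemma orb_diag: "x \<in> X \<Longrightarrow> y \<in> X \<Longrightarrow> u \<in> X \<Longrightarrow> orb x y = orb u u \<Longrightarrow> x = y"
  using orb_eqD by blast

proposition oriented_groupoid_GXH: "oriented_groupoid (GXH X H act)"
proof (rule oriented_groupoid.intro, goal_cases)
  case (1 a) then show ?case unfolding arr_eq using orbit_src by blast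
next
  case (2 a) then show ?case unfolding arr_eq using orbit_rng by blast
next
  case (7 a b)
  then obtain x y z where "x \<in> X" "y \<in> X" "z \<in> X" "a = orb x y" "b = orb y z" by (rule composableE)
  then show ?case by (auto simp: orbit_mul arr_eq)
next
  case (8 a b)
  then obtain x y z where "x \<in> X" "y \<in> X" "z \<in> X" "a = orb x y" "b = orb y z" by (rule composableE)
  then show ?case by (simp add: orbit_mul orbit_src)
next
  case (9 a b)
  then obtain x y z where "x \<in> X" "y \<in> X" "z \<in> X" "a = orb x y" "b = orb y z" by (rule composableE)
  then show ?case by (simp add: orbit_mul orbit_rng)
next
  case (10 a b c)
  then obtain x y z where 1: "x \<in> X" "y \<in> X" "z \<in> X" "a = orb x y" "b = orb y z"
    using composableE[OF 10(1,2,4)] by blast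
  obtain u v where uv: "u \<in> X" "v \<in> X" "c = orb u v" using 10 arr_eq by auto
  have "orb z z = orb u u" using 10(5) 1 uv orbit_src orbit_rng by simp
  then obtain h where h: "h \<in> H" "z = act h u" using orb_eqD 1 by blast
  then have "c = orb z (act h v)" "act h v \<in> X" using uv orb_act act_closed by auto
  then show ?case using 1 orbit_mul by simp
next
  case (13 a) then show ?case using inverses_singleton by (auto simp: arr_eq)
next
  case 14 then show ?case by (auto simp: arr_eq pos_eq)
next
  case (15 a b)
  then have "a \<in> Arr (GXH X H act)" "b \<in> Arr (GXH X H act)" by (auto simp: arr_eq pos_eq)
  from composableE[OF this 15(3)] obtain x y z where
    1: "x \<in> X" "y \<in> X" "z \<in> X" "a = orb x y" "b = orb y z" .
  then have "x \<ge> y" "y \<ge> z" using 15 orbit_pos_iff by auto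
  then show ?case using 1 orbit_mul orbit_pos_iff by (metis order_trans)
next
  case 16
  show ?case
  proof
    show "Pos (GXH X H act) \<inter> inverses (GXH X H act) (Pos (GXH X H act)) \<subseteq> Units (GXH X H act)"
    proof
      fix a assume "a \<in> Pos (GXH X H act) \<inter> inverses (GXH X H act) (Pos (GXH X H act))"
      then obtain x y where "x \<in> X" "y \<in> X" "x \<le> y" "a = orb x y" "a \<in> Pos (GXH X H act)"
        unfolding inverses_pos by blast
      then show "a \<in> Units (GXH X H act)" using orbit_pos_iff unit_eq by force
    qed
    show "Units (GXH X H act) \<subseteq> Pos (GXH X H act) \<inter> inverses (GXH X H act) (Pos (GXH X H act))"
      unfolding inverses_pos unit_eq unfolding pos_eq by blast
  qed
next
  case 17
  have "x \<le> y \<or> y \<le> x" for x y :: 'a by auto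
  then show ?case unfolding inverses_pos unfolding pos_eq arr_eq by blast
qed (auto simp: arr_eq orbit_src orbit_rng orbit_mul)

end


section \<open>The groupoids \<open>\<gg>(m)\<close>\<close>

text \<open>
  \<open>\<int>/(m+1)\<int>\<close> is represented by the residues \<open>{0..m}\<close>; the unit \<open>a\<close> is the element \<open>(a, 0)\<close>.
\<close>

definition gcyc :: "nat \<Rightarrow> (int \<times> int) ogrpd" where
  "gcyc m =
     \<lparr> Arr = {0..int m} \<times> UNIV,
       Src = (\<lambda>(a, h). (a, 0)),
       Rng = (\<lambda>(a, h). ((a + h) mod (int m + 1), 0)),
       Mul = (\<lambda>(a, h) (a', h'). (a', h + h')),
       Pos = {0..int m} \<times> {0..} \<rparr>"

proposition oriented_groupoid_gcyc: "oriented_groupoid (gcyc m)"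
proof -
  have b: "0 \<le> x mod (int m + 1)" "x mod (int m + 1) \<le> int m" for x
    using pos_mod_bound[of "int m + 1" x] by auto
  have s: "x mod (int m + 1) = x" if "0 \<le> x" "x \<le> int m" for x using that by simp
  have i: "((a + h) mod (int m + 1) - h) mod (int m + 1) = a" if "0 \<le> a" "a \<le> int m" for a h
    using that by (simp add: mod_diff_left_eq)
  have i': "((a + h) mod (int m + 1) + - h) mod (int m + 1) = a" if "0 \<le> a" "a \<le> int m" for a h
    using i[OF that, of h] by simp
  have inv: "((a + h) mod (int m + 1), - h) \<in> inverses (gcyc m) {(a, h)}"
    if "0 \<le> a" "a \<le> int m" for a h
    using that b i' by (auto simp: inverses_def gcyc_def)
  have neg: "inverses (gcyc m) (Pos (gcyc m)) = {0..int m} \<times> {..0}"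
  proof
    show "inverses (gcyc m) (Pos (gcyc m)) \<subseteq> {0..int m} \<times> {..0}"
      by (auto simp: inverses_def gcyc_def)
    show "{0..int m} \<times> {..0} \<subseteq> inverses (gcyc m) (Pos (gcyc m))"
    proof
      fix p :: "int \<times> int" assume "p \<in> {0..int m} \<times> {..0}"
      then obtain a h where p: "p = (a, h)" "0 \<le> a" "a \<le> int m" "h \<le> 0" by auto
      define q where "q = ((a + h) mod (int m + 1), - h)"
      have "q \<in> Pos (gcyc m)" using p b by (auto simp: q_def gcyc_def)
      moreover have "p \<in> inverses (gcyc m) {q}"
        using inv[of "(a + h) mod (int m + 1)" "- h"] p b i' unfolding q_def by simp
      ultimately show "p \<in> inverses (gcyc m) (Pos (gcyc m))" by (auto simp: inverses_def)
    qed
  qed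
  show ?thesis
  proof (unfold_locales, goal_cases)
    case (13 a) then show ?case using inv by (force simp: gcyc_def)
  next
    case 16 show ?case unfolding neg by (auto simp: gcyc_def Units_def image_iff)
  next
    case 17 show ?case unfolding neg by (auto simp: gcyc_def)
  next
    case (9 a b)
    then show ?case
      by (auto simp: gcyc_def) (metis ab_semigroup_add_class.add_ac(1) add.commute mod_add_left_eq)
  qed (auto simp: gcyc_def b s)
qed


section \<open>Categories and flat functors\<close>

record ('o, 'm) cat =
  Ob :: "'o set"
  Hom :: "'o \<Rightarrow> 'o \<Rightarrow> 'm set"
  Id :: "'o \<Rightarrow> 'm"
  Comp :: "'m \<Rightarrow> 'm \<Rightarrow> 'm"  \<comment> \<open>\<open>Comp C g f\<close> is \<open>g \<circ> f\<close>\<close>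

locale category =
  fixes C :: "('o, 'm) cat"
  assumes id_in: "c \<in> Ob C \<Longrightarrow> Id C c \<in> Hom C c c"
    and comp_in: "\<lbrakk>c \<in> Ob C; d \<in> Ob C; e \<in> Ob C; f \<in> Hom C c d; g \<in> Hom C d e\<rbrakk>
                    \<Longrightarrow> Comp C g f \<in> Hom C c e"
    and comp_id: "\<lbrakk>c \<in> Ob C; d \<in> Ob C; f \<in> Hom C c d\<rbrakk> \<Longrightarrow> Comp C f (Id C c) = f"
    and id_comp: "\<lbrakk>c \<in> Ob C; d \<in> Ob C; f \<in> Hom C c d\<rbrakk> \<Longrightarrow> Comp C (Id C d) f = f"
    and comp_assoc: "\<lbrakk>b \<in> Ob C; c \<in> Ob C; d \<in> Ob C; e \<in> Ob C;
                      f \<in> Hom C b c; g \<in> Hom C c d; h \<in> Hom C d e\<rbrakk>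
                    \<Longrightarrow> Comp C h (Comp C g f) = Comp C (Comp C h g) f"

definition op_cat :: "('o, 'm) cat \<Rightarrow> ('o, 'm) cat" where
  "op_cat C = \<lparr> Ob = Ob C, Hom = (\<lambda>c d. Hom C d c), Id = Id C, Comp = (\<lambda>g f. Comp C f g) \<rparr>"

text \<open>
  The hom-sets of a \<open>cat\<close> need not be disjoint; hence the action \<open>Fm c d f\<close> of a functor on
  \<open>f \<in> Hom C c d\<close> takes source and target as explicit arguments.
\<close>

locale set_functor = category C for C :: "('o, 'm) cat" +
  fixes Fo :: "'o \<Rightarrow> 's set" and Fm :: "'o \<Rightarrow> 'o \<Rightarrow> 'm \<Rightarrow> 's \<Rightarrow> 's"
  assumes map_in: "\<lbrakk>c \<in> Ob C; d \<in> Ob C; f \<in> Hom C c d; x \<in> Fo c\<rbrakk> \<Longrightarrow> Fm c d f x \<in> Fo d"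
    and map_id: "\<lbrakk>c \<in> Ob C; x \<in> Fo c\<rbrakk> \<Longrightarrow> Fm c c (Id C c) x = x"
    and map_comp: "\<lbrakk>c \<in> Ob C; d \<in> Ob C; e \<in> Ob C; f \<in> Hom C c d; g \<in> Hom C d e; x \<in> Fo c\<rbrakk>
                     \<Longrightarrow> Fm c e (Comp C g f) x = Fm d e g (Fm c d f x)"

definition elements_cat ::
    "('o, 'm) cat \<Rightarrow> ('o \<Rightarrow> 's set) \<Rightarrow> ('o \<Rightarrow> 'o \<Rightarrow> 'm \<Rightarrow> 's \<Rightarrow> 's) \<Rightarrow> ('o \<times> 's, 'm) cat" where
  "elements_cat C Fo Fm =
     \<lparr> Ob = {(c, x). c \<in> Ob C \<and> x \<in> Fo c},
       Hom = (\<lambda>(c, x) (d, y). {f \<in> Hom C c d. Fm c d f x = y}),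
       Id = (\<lambda>(c, x). Id C c),
       Comp = Comp C \<rparr>"

text \<open>This is the convention in which flatness of a covariant functor to sets is expressed by its
  category of elements, i.e. cones are taken \<^emph>\<open>over\<close> the given data.\<close>

definition filtering :: "('o, 'm) cat \<Rightarrow> bool" where
  "filtering C \<longleftrightarrow>
     Ob C \<noteq> {} \<and>
     (\<forall>i\<in>Ob C. \<forall>j\<in>Ob C. \<exists>k\<in>Ob C. Hom C k i \<noteq> {} \<and> Hom C k j \<noteq> {}) \<and>
     (\<forall>i\<in>Ob C. \<forall>j\<in>Ob C. \<forall>\<alpha>\<in>Hom C i j. \<forall>\<beta>\<in>Hom C i j.
        \<exists>k\<in>Ob C. \<exists>\<gamma>\<in>Hom C k i. Comp C \<alpha> \<gamma> = Comp C \<beta> \<gamma>)"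

definition flat_functor ::
    "('o, 'm) cat \<Rightarrow> ('o \<Rightarrow> 's set) \<Rightarrow> ('o \<Rightarrow> 'o \<Rightarrow> 'm \<Rightarrow> 's \<Rightarrow> 's) \<Rightarrow> bool" where
  "flat_functor C Fo Fm \<longleftrightarrow> set_functor C Fo Fm \<and> filtering (elements_cat C Fo Fm)"


section \<open>The epicyclic category\<close>

definition epi_map :: "nat \<Rightarrow> nat \<Rightarrow> (int \<Rightarrow> int) \<Rightarrow> bool" where
  "epi_map n m f \<longleftrightarrow> mono f \<and> (\<exists>k>0. \<forall>x. f (x + int n + 1) = f x + k * (int m + 1))"

definition shift_rel :: "nat \<Rightarrow> ((int \<Rightarrow> int) \<times> (int \<Rightarrow> int)) set" where
  "shift_rel m = {(f, g). \<exists>a. \<forall>x. g x = f x + a * (int m + 1)}"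

definition epicyclic :: "(nat, (int \<Rightarrow> int) set) cat" where
  "epicyclic =
     \<lparr> Ob = UNIV,
       Hom = (\<lambda>n m. {f. epi_map n m f} // shift_rel m),
       Id = (\<lambda>n. shift_rel n `` {id}),
       Comp = (\<lambda>\<psi> \<phi>. {g \<circ> f | g f. g \<in> \<psi> \<and> f \<in> \<phi>}) \<rparr>"

text \<open>
  The morphism \<open>(x,y) \<mapsto> (f x, f y)\<close> from \<open>\<gg>(n)\<close> to \<open>\<gg>(m)\<close> induced by a class \<open>\<phi>\<close> of maps \<open>f\<close>, transported
  along the isomorphism \<open>(x,y) \<mapsto> (y mod (m+1), x - y)\<close> with the quotient of \<open>\<int> \<times> \<int>\<close>: the element \<open>(a,h)\<close>
  is the class of \<open>(a + h, a)\<close>. Lemma \<open>epi_act_eq\<close> shows independence of all choices.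
\<close>

definition epi_act :: "nat \<Rightarrow> nat \<Rightarrow> (int \<Rightarrow> int) set \<Rightarrow> int \<times> int \<Rightarrow> int \<times> int" where
  "epi_act n m \<phi> = (\<lambda>(a, h) \<in> Arr (gcyc n).
     let f = (SOME f. f \<in> \<phi>) in (f a mod (int m + 1), f (a + h) - f a))"

lemma epi_map_shift: "epi_map n m f \<Longrightarrow> \<exists>k>0. \<forall>t x. f (x + t * (int n + 1)) = f x + t * k * (int m + 1)"
proof -
  assume "epi_map n m f"
  then obtain k where k: "k > 0" "\<And>x. f (x + int n + 1) = f x + k * (int m + 1)"
    by (auto simp: epi_map_def)
  have "f (x + t * (int n + 1)) = f x + t * k * (int m + 1)" for t x
  proof (induction t rule: int_induct[where k = 0])
    case (step1 i) then show ?case using k(2)[of "x + i * (int n + 1)"] by (simp add: algebra_simps)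
  next
    case (step2 i) then show ?case
      using k(2)[of "x + (i - 1) * (int n + 1)"] by (simp add: algebra_simps)
  qed simp
  then show ?thesis using k(1) by blast
qed

lemma epi_act_eq:
  assumes "\<phi> \<in> Hom epicyclic n m" "f \<in> \<phi>"
  shows "epi_act n m \<phi> (y mod (int n + 1), x - y) = (f y mod (int m + 1), f x - f y)"
proof -
  define g where "g = (SOME g. g \<in> \<phi>)"
  have "g \<in> \<phi>" unfolding g_def using assms(2) by (rule someI[of "\<lambda>g. g \<in> \<phi>"])
  obtain f0 where f0: "epi_map n m f0" "\<phi> = shift_rel m `` {f0}"
    using assms(1) by (auto simp: epicyclic_def quotient_def)
  from f0 \<open>g \<in> \<phi>\<close> obtain b where b: "\<And>x. g x = f0 x + b * (int m + 1)" by (auto simp: shift_rel_def)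
  from f0 assms(2) obtain c where c: "\<And>x. f x = f0 x + c * (int m + 1)" by (auto simp: shift_rel_def)
  obtain k where k: "\<And>t x. f0 (x + t * (int n + 1)) = f0 x + t * k * (int m + 1)"
    using epi_map_shift[OF f0(1)] by blast
  define q a where "q = y div (int n + 1)" and "a = y mod (int n + 1)"
  have y: "y = a + q * (int n + 1)" unfolding q_def a_def by (rule mod_div_mult_eq[symmetric])
  have x: "x = (a + (x - y)) + q * (int n + 1)" using y by simp
  have fy: "f y = g a + (c - b + q * k) * (int m + 1)"
    using k[of a q] b[of a] c[of y] y by (simp add: algebra_simps)
  have fx: "f x = g (a + (x - y)) + (c - b + q * k) * (int m + 1)"
    using k[of "a + (x - y)" q] b[of "a + (x - y)"] c[of x] x by (simp add: algebra_simps)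
  have "(a, x - y) \<in> Arr (gcyc n)"
    using pos_mod_bound[of "int n + 1" y] unfolding a_def gcyc_def by simp
  moreover have "f y mod (int m + 1) = g a mod (int m + 1)" unfolding fy by simp
  ultimately show ?thesis using fx fy unfolding epi_act_def a_def[symmetric] g_def[symmetric] by simp
qed


section \<open>The functor \<open>\<^bold>n \<mapsto> Hom(\<gg>(n), G)\<close>\<close>

definition F_obj :: "'a ogrpd \<Rightarrow> nat \<Rightarrow> (int \<times> int \<Rightarrow> 'a) set" where
  "F_obj G n = Hom_g (gcyc n) G"

text \<open>\<open>F_mor m n \<phi> : F_obj G m \<rightarrow> F_obj G n\<close> for \<open>\<phi>\<close> a morphism \<open>m \<rightarrow> n\<close> in the opposite category, that is,
  \<open>\<phi> : n \<rightarrow> m\<close> in \<open>epicyclic\<close>.\<close>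

definition F_mor :: "nat \<Rightarrow> nat \<Rightarrow> (int \<Rightarrow> int) set \<Rightarrow> (int \<times> int \<Rightarrow> 'a) \<Rightarrow> (int \<times> int \<Rightarrow> 'a)" where
  "F_mor m n \<phi> \<xi> = compose (Arr (gcyc n)) \<xi> (epi_act n m \<phi>)"

end

theory Submission
  imports Defs
begin

text \<open>
  Since \<open>H\<close> acts freely, a non-trivial morphism \<open>\<gg>(n) \<rightarrow> G(X,H)\<close> lifts to a non-decreasing map
  \<open>f : \<int> \<rightarrow> X\<close> with \<open>f(x + n + 1) = h + f(x)\<close> for some \<open>h > 0\<close> in \<open>H\<close>, unique up to translation by \<open>H\<close>,
  and morphisms of the epicyclic category act by precomposition on lifts. Any two elements of
  \<open>H \<subseteq> \<rat>\<close> are integer multiples of a common \<open>c > 0\<close> in \<open>H\<close>. As \<open>X\<close> is archimedean, a finitely generated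
  \<open>\<int>c\<close>-invariant subset of \<open>X\<close> is order isomorphic to \<open>\<int>\<close> with \<open>c\<close> acting as a shift by some \<open>p + 1\<close>, so
  its enumeration is itself a lift. Every lift with values in this subset whose \<open>h\<close> is a multiple of \<open>c\<close>
  factors uniquely through the enumeration, and both filtering conditions follow.
\<close>

section \<open>The epicyclic category\<close>

lemma shift_class_iff: "g \<in> shift_rel m `` {f} \<longleftrightarrow> (\<exists>a. \<forall>x. g x = f x + a * (int m + 1))"
  by (simp add: shift_rel_def)

lemma shift_class_self: "f \<in> shift_rel m `` {f}"
  unfolding shift_class_iff by (intro exI[of _ 0]) simp

lemma shift_class_eqI:
  assumes "\<And>x. g x = f x + a * (int m + 1)"
  shows "shift_rel m `` {f} = shift_rel m `` {g}"
proof (rule set_eqI, unfold shift_class_iff, rule iffI)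
  fix u assume "\<exists>b. \<forall>x. u x = f x + b * (int m + 1)"
  then obtain b where "\<And>x. u x = f x + b * (int m + 1)" by blast
  then have "u x = g x + (b - a) * (int m + 1)" for x using assms by (simp add: algebra_simps)
  then show "\<exists>b. \<forall>x. u x = g x + b * (int m + 1)" by blast
next
  fix u assume "\<exists>b. \<forall>x. u x = g x + b * (int m + 1)"
  then obtain b where "\<And>x. u x = g x + b * (int m + 1)" by blast
  then have "u x = f x + (b + a) * (int m + 1)" for x using assms by (simp add: algebra_simps)
  then show "\<exists>b. \<forall>x. u x = f x + b * (int m + 1)" by blast
qed

lemma Hom_epicyclic_iff:
  "\<phi> \<in> Hom epicyclic n m \<longleftrightarrow> (\<exists>f. epi_map n m f \<and> \<phi> = shift_rel m `` {f})"
  by (auto simp: epicyclic_def quotient_def)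

lemma Hom_epicyclicE:
  assumes "\<phi> \<in> Hom epicyclic n m"
  obtains f where "epi_map n m f" "\<phi> = shift_rel m `` {f}" "f \<in> \<phi>"
  using assms shift_class_self unfolding Hom_epicyclic_iff by blast

section \<open>Composition of epicyclic maps and the category axioms\<close>

lemma epi_map_id: "epi_map n n id"
  unfolding epi_map_def by (auto simp: mono_def intro: exI[of _ 1])

lemma epi_map_comp:
  assumes "epi_map n m f" "epi_map m p g"
  shows "epi_map n p (g \<circ> f)"
proof -
  obtain k where k: "k > 0" "\<And>x. f (x + int n + 1) = f x + k * (int m + 1)"
    using assms(1) by (auto simp: epi_map_def)
  obtain l where l: "l > 0" "\<And>t x. g (x + t * (int m + 1)) = g x + t * l * (int p + 1)"
    using epi_map_shift[OF assms(2)] by blast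
  have "mono (g \<circ> f)" using assms by (auto simp: epi_map_def mono_def)
  moreover have "\<forall>x. (g \<circ> f) (x + int n + 1) = (g \<circ> f) x + (k * l) * (int p + 1)"
    using k l by simp
  ultimately show ?thesis using k(1) l(1) mult_pos_pos[of k l] unfolding epi_map_def by blast
qed

text \<open>Shifting \<open>f\<close> by \<open>b * (m + 1)\<close> shifts
  \<open>g \<circ> f\<close> by \<open>b * l * (p + 1)\<close>, so no composite of representatives
  leaves the class of \<open>g \<circ> f\<close>. Conversely, shifting \<open>g\<close> alone
  already reaches the whole class.\<close>

lemma comp_class:
  assumes "epi_map m p g"
  shows "Comp epicyclic (shift_rel p `` {g}) (shift_rel m `` {f}) = shift_rel p `` {g \<circ> f}"
proof -
  obtain l where l: "l > 0" "\<And>t x. g (x + t * (int m + 1)) = g x + t * l * (int p + 1)"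
    using epi_map_shift[OF assms] by blast
  have "{g' \<circ> f' | g' f'. g' \<in> shift_rel p `` {g} \<and> f' \<in> shift_rel m `` {f}} = shift_rel p `` {g \<circ> f}"
  proof (intro equalityI subsetI)
    fix u assume "u \<in> {g' \<circ> f' | g' f'. g' \<in> shift_rel p `` {g} \<and> f' \<in> shift_rel m `` {f}}"
    then obtain g' f' a b where "u = g' \<circ> f'" "\<And>x. g' x = g x + a * (int p + 1)"
      "\<And>x. f' x = f x + b * (int m + 1)" unfolding shift_class_iff by blast
    then have "u x = g (f x + b * (int m + 1)) + a * (int p + 1)" for x by simp
    then have "u x = (g \<circ> f) x + (a + b * l) * (int p + 1)" for x
      using l(2)[of "f x" b] by (simp only: comp_apply distrib_right add.assoc mult.assoc)
    then show "u \<in> shift_rel p `` {g \<circ> f}" unfolding shift_class_iff by blast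
  next
    fix u assume "u \<in> shift_rel p `` {g \<circ> f}"
    then obtain a where a: "\<And>x. u x = g (f x) + a * (int p + 1)" unfolding shift_class_iff by auto
    then have "u = (\<lambda>x. g x + a * (int p + 1)) \<circ> f" by auto
    moreover have "(\<lambda>x. g x + a * (int p + 1)) \<in> shift_rel p `` {g}" unfolding shift_class_iff by blast
    ultimately show "u \<in> {g' \<circ> f' | g' f'. g' \<in> shift_rel p `` {g} \<and> f' \<in> shift_rel m `` {f}}"
      using shift_class_self by blast
  qed
  then show ?thesis by (simp add: epicyclic_def)
qed

lemma Id_epicyclic: "Id epicyclic n = shift_rel n `` {id}"
  by (simp add: epicyclic_def)

lemma category_epicyclic: "category epicyclic"
proof (unfold_locales, goal_cases)
  case (1 c) then show ?case unfolding Hom_epicyclic_iff Id_epicyclic using epi_map_id by blast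
next
  case (2 c d e \<phi> \<psi>)
  then show ?case unfolding Hom_epicyclic_iff using comp_class epi_map_comp by metis
next
  case (3 c d \<phi>)
  then show ?case unfolding Hom_epicyclic_iff Id_epicyclic using comp_class by fastforce
next
  case (4 c d \<phi>)
  then show ?case unfolding Hom_epicyclic_iff Id_epicyclic using comp_class[OF epi_map_id] by fastforce
next
  case (5 b c d e \<phi> \<psi> \<chi>)
  obtain f where f: "epi_map b c f" "\<phi> = shift_rel c `` {f}" using 5(5) by (rule Hom_epicyclicE)
  obtain g where g: "epi_map c d g" "\<psi> = shift_rel d `` {g}" using 5(6) by (rule Hom_epicyclicE)
  obtain h where h: "epi_map d e h" "\<chi> = shift_rel e `` {h}" using 5(7) by (rule Hom_epicyclicE)
  show ?case unfolding f(2) g(2) h(2) comp_class[OF g(1)] comp_class[OF h(1)]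
      comp_class[OF epi_map_comp[OF g(1) h(1)]] by (simp add: comp_assoc)
qed

lemma category_op_cat:
  assumes "category C" shows "category (op_cat C)"
proof -
  interpret category C by fact
  show ?thesis
    by unfold_locales (auto simp: op_cat_def id_in comp_id id_comp intro: comp_in comp_assoc[symmetric])
qed


section \<open>Lifts of morphisms\<close>

lemma gcyc_simps [simp]:
  "p \<in> Arr (gcyc n) \<longleftrightarrow> 0 \<le> fst p \<and> fst p \<le> int n"
  "Src (gcyc n) (a, h) = (a, 0)"
  "Rng (gcyc n) (a, h) = ((a + h) mod (int n + 1), 0)"
  "Mul (gcyc n) (a, h) (b, k) = (b, h + k)"
  "p \<in> Pos (gcyc n) \<longleftrightarrow> 0 \<le> fst p \<and> fst p \<le> int n \<and> 0 \<le> snd p"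
  by (cases p; auto simp: gcyc_def)+

lemma residue_le: "x mod (int n + 1) \<le> int n"
  using pos_mod_bound[of "int n + 1" x] by simp

context free_rat_order_action
begin

section \<open>Integer multiples, monotonicity and cancellation for the action\<close>

lemma act_of_int_closed: "h \<in> H \<Longrightarrow> of_int k * h \<in> H"
proof (induction k rule: int_induct[where k = 0])
  case (step1 i) then show ?case using H_add by (simp add: algebra_simps)
next
  case (step2 i) then show ?case using H_add[of "of_int i * h" "- h"] H_uminus by (simp add: algebra_simps)
qed (simp add: H_zero)

lemma act_le: "h \<in> H \<Longrightarrow> x \<in> X \<Longrightarrow> y \<in> X \<Longrightarrow> x \<le> y \<Longrightarrow> act h x \<le> act h y"
  using act_strict_mono[of h] by (metis order_le_less strict_mono_onD)

lemma act_less: "h \<in> H \<Longrightarrow> x \<in> X \<Longrightarrow> y \<in> X \<Longrightarrow> x < y \<Longrightarrow> act h x < act h y"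
  using act_strict_mono[of h] by (metis strict_mono_onD)

lemma act_mono_left:
  assumes "h \<in> H" "k \<in> H" "x \<in> X" "h \<le> k" shows "act h x \<le> act k x"
proof (cases "h = k")
  case False
  have m: "k - h \<in> H" using H_add[of k "- h"] H_uminus assms by simp
  have "act (k - h) (act h x) > act h x" using False assms act_gt[OF m] act_closed by simp
  then show ?thesis using act_add[OF m assms(1,3)] by simp
qed simp

text \<open>The element of \<open>H\<close> carrying one pair to the other fixes \<open>z\<close>,
  hence is \<open>0\<close> by freeness.\<close>

lemma orb_cancel_right:
  assumes "x \<in> X" "y \<in> X" "z \<in> X" "orb x z = orb y z" shows "x = y"
proof -
  obtain h where h: "h \<in> H" "x = act h y" "z = act h z" using orb_eqD assms by metis
  then have "h = 0" using act_eq[OF h(1) H_zero assms(3)] act_zero assms by simp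
  then show ?thesis using h act_zero assms by simp
qed

text \<open>The group element \<open>h\<close> records the image of the loop that goes once around
  \<open>gcyc n\<close>; requiring \<open>h > 0\<close> encodes non-triviality of the
  morphism.\<close>

definition is_lift :: "nat \<Rightarrow> rat \<Rightarrow> (int \<Rightarrow> 'a) \<Rightarrow> bool" where
  "is_lift n h f \<longleftrightarrow> h \<in> H \<and> h > 0 \<and> mono f \<and> range f \<subseteq> X \<and> (\<forall>x. f (x + int n + 1) = act h (f x))"

text \<open>This is \<open>(x, y)\<close> going to the orbit of \<open>(f x, f y)\<close>, with
  \<open>(a, h)\<close> standing for the class of \<open>(a + h, a)\<close>. Here \<open>h\<close>
  is an integer displacement, not the group element of \<open>is_lift\<close>.\<close>

definition lift_mor :: "nat \<Rightarrow> (int \<Rightarrow> 'a) \<Rightarrow> int \<times> int \<Rightarrow> ('a \<times> 'a) set" where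
  "lift_mor n f = (\<lambda>(a, h) \<in> Arr (gcyc n). orb (f (a + h)) (f a))"

section \<open>Equivariance of lifts and the correspondence with non-trivial morphisms\<close>

lemma is_liftD:
  assumes "is_lift n h f"
  shows "h \<in> H" "h > 0" "mono f" "f x \<in> X" "f (x + int n + 1) = act h (f x)"
  using assms by (auto simp: is_lift_def)

lemma lift_shift:
  assumes "is_lift n h f"
  shows "f (x + t * (int n + 1)) = act (of_int t * h) (f x)"
proof (induction t rule: int_induct[where k = 0])
  case base then show ?case using act_zero is_liftD[OF assms] by simp
next
  case (step1 i)
  have "f (x + (i + 1) * (int n + 1)) = act h (f (x + i * (int n + 1)))"
    using is_liftD(5)[OF assms, of "x + i * (int n + 1)"] by (simp add: algebra_simps)
  also have "\<dots> = act (h + of_int i * h) (f x)"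
    using step1 act_add act_of_int_closed is_liftD[OF assms] by simp
  finally show ?case by (simp add: algebra_simps)
next
  case (step2 i)
  have "act h (f (x + (i - 1) * (int n + 1))) = f (x + i * (int n + 1))"
    using is_liftD(5)[OF assms, of "x + (i - 1) * (int n + 1)"] by (simp add: algebra_simps)
  then have "f (x + (i - 1) * (int n + 1)) = act (- h) (act (of_int i * h) (f x))"
    using step2 act_minus is_liftD[OF assms] by metis
  also have "\<dots> = act (- h + of_int i * h) (f x)"
    using act_add[of "- h" "of_int i * h" "f x"] H_uminus act_of_int_closed is_liftD[OF assms] by simp
  finally show ?case by (simp add: algebra_simps)
qed

lemma lift_mod:
  assumes "is_lift n h f"
  shows "f x = act (of_int (x div (int n + 1)) * h) (f (x mod (int n + 1)))"
  using lift_shift[OF assms, of "x mod (int n + 1)" "x div (int n + 1)"] unfolding mod_div_mult_eq .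

text \<open>Reducing \<open>y\<close> modulo \<open>n + 1\<close> moves both arguments by the same
  multiple of \<open>n + 1\<close>; equivariance turns this into a diagonal translation by an
  element of \<open>H\<close>, which \<open>orb\<close> absorbs.\<close>

lemma lift_mor_eq:
  assumes "is_lift n h f"
  shows "lift_mor n f (y mod (int n + 1), x - y) = orb (f x) (f y)"
proof -
  define a q where "a = y mod (int n + 1)" and "q = y div (int n + 1)"
  have y: "y = a + q * (int n + 1)" unfolding a_def q_def by (rule mod_div_mult_eq[symmetric])
  have "x = (a + (x - y)) + q * (int n + 1)" using y by simp
  then have "f x = act (of_int q * h) (f (a + (x - y)))" "f y = act (of_int q * h) (f a)"
    using lift_shift[OF assms] y by metis+
  then have "orb (f x) (f y) = orb (f (a + (x - y))) (f a)"
    using orb_act act_of_int_closed is_liftD[OF assms] by simp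
  then show ?thesis unfolding a_def[symmetric] using residue_le[of y n]
    by (simp add: lift_mor_def a_def)
qed

lemma lift_mor_in: "0 \<le> a \<Longrightarrow> a \<le> int n \<Longrightarrow> lift_mor n f (a, h) = orb (f (a + h)) (f a)"
  by (simp add: lift_mor_def)

lemma lift_mor_F_obj:
  assumes "is_lift n h f" shows "lift_mor n f \<in> F_obj (GXH X H act) n"
proof -
  note X = is_liftD(4)[OF assms]
  have "og_morphism (gcyc n) (GXH X H act) (lift_mor n f)"
    unfolding og_morphism_def
  proof (intro conjI ballI impI)
    show "lift_mor n f \<in> Arr (gcyc n) \<rightarrow>\<^sub>E Arr (GXH X H act)"
      using X unfolding arr_eq by (auto simp: lift_mor_def PiE_def)
    show "lift_mor n f ` Pos (gcyc n) \<subseteq> Pos (GXH X H act)"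
    proof clarify
      fix a b assume "(a, b) \<in> Pos (gcyc n)"
      then show "lift_mor n f (a, b) \<in> Pos (GXH X H act)"
        using orbit_pos_iff[OF X X] is_liftD(3)[OF assms] by (auto simp: lift_mor_in mono_def)
    qed
    fix p assume p: "p \<in> Arr (gcyc n)"
    obtain a k where a: "p = (a, k)" "0 \<le> a" "a \<le> int n" using p by (cases p) auto
    show "lift_mor n f (Src (gcyc n) p) = Src (GXH X H act) (lift_mor n f p)"
      using a by (simp add: lift_mor_in orbit_src)
    show "lift_mor n f (Rng (gcyc n) p) = Rng (GXH X H act) (lift_mor n f p)"
      using a lift_mor_eq[OF assms, of "a + k" "a + k"] by (simp add: lift_mor_in orbit_rng)
    fix q assume q: "q \<in> Arr (gcyc n)" "Src (gcyc n) p = Rng (gcyc n) q"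
    obtain b l where b: "q = (b, l)" "0 \<le> b" "b \<le> int n" using q by (cases q) auto
    have "a = (b + l) mod (int n + 1)" using q a b by simp
    then have "lift_mor n f p = orb (f (b + l + k)) (f (b + l))"
      using lift_mor_eq[OF assms, of "b + l" "b + l + k"] a by simp
    then show "lift_mor n f (Mul (gcyc n) p q) = Mul (GXH X H act) (lift_mor n f p) (lift_mor n f q)"
      using a b orbit_mul[OF X X X] by (simp add: lift_mor_in add.assoc add.commute[of k])
  qed
  \<comment> \<open>The loop of length \<open>n + 1\<close> at \<open>0\<close> goes to the orbit of
    \<open>(act h (f 0), f 0)\<close>, which is off the diagonal because \<open>h > 0\<close> moves
    every point upwards.\<close>
  moreover have "lift_mor n f (0, int n + 1) \<notin> Units (GXH X H act)"
  proof
    assume "lift_mor n f (0, int n + 1) \<in> Units (GXH X H act)"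
    then have "f (int n + 1) = f 0" using orb_diag X unfolding unit_eq by (auto simp: lift_mor_in)
    then show False using is_liftD(5)[OF assms, of 0] act_gt[of h "f 0"] X is_liftD[OF assms] by simp
  qed
  ultimately show ?thesis unfolding F_obj_def Hom_g_def by force
qed

text \<open>After a base point \<open>x0\<close> over the unit \<open>(0, 0)\<close> is fixed, each
  arrow \<open>(0, x)\<close> issuing from that unit has image \<open>orb (f x) x0\<close> for a
  unique \<open>f x\<close>. Multiplicativity then determines \<xi> on all arrows, and positivity
  makes \<open>f\<close> monotone.\<close>

lemma F_obj_lift:
  assumes "\<xi> \<in> F_obj (GXH X H act) n"
  obtains f h where "is_lift n h f" "\<xi> = lift_mor n f"
proof -
  let ?G = "GXH X H act" and ?N = "int n + 1"
  have mor: "og_morphism (gcyc n) ?G \<xi>" and nt: "\<not> (\<forall>a\<in>Arr (gcyc n). \<xi> a \<in> Units ?G)"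
    using assms by (auto simp: F_obj_def Hom_g_def)
  have arr: "\<xi> p \<in> Arr ?G" if "p \<in> Arr (gcyc n)" for p
    using mor that unfolding og_morphism_def by blast
  have src: "\<xi> (Src (gcyc n) p) = Src ?G (\<xi> p)" and rng: "\<xi> (Rng (gcyc n) p) = Rng ?G (\<xi> p)"
    if "p \<in> Arr (gcyc n)" for p using mor that unfolding og_morphism_def by blast+
  have mul: "\<xi> (Mul (gcyc n) p q) = Mul ?G (\<xi> p) (\<xi> q)"
    if "p \<in> Arr (gcyc n)" "q \<in> Arr (gcyc n)" "Src (gcyc n) p = Rng (gcyc n) q" for p q
    using mor that unfolding og_morphism_def by blast
  have pos: "\<xi> p \<in> Pos ?G" if "p \<in> Pos (gcyc n)" for p
    using mor that unfolding og_morphism_def by blast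
  obtain x0 where x0: "x0 \<in> X" "\<xi> (0, 0) = orb x0 x0"
  proof -
    obtain x y where "x \<in> X" "y \<in> X" "\<xi> (0, 0) = orb x y" using arr[of "(0, 0)"] by (auto simp: arr_eq)
    then show thesis using that src[of "(0, 0)"] orbit_src by simp
  qed
  \<comment> \<open>An arrow with prescribed source can be translated so that its second coordinate
    is the chosen representative \<open>y\<close>.\<close>
  have normal: "\<exists>z\<in>X. g = orb z y"
    if g: "g \<in> Arr ?G" "Src ?G g = orb y y" "y \<in> X" for g y
  proof -
    obtain u v where uv: "u \<in> X" "v \<in> X" "g = orb u v" using g by (auto simp: arr_eq)
    then have "orb y y = orb v v" using g uv orbit_src by simp
    then obtain h where h: "h \<in> H" "y = act h v" using orb_eqD g(3) by blast
    then have "g = orb (act h u) y" "act h u \<in> X" using h uv orb_act act_closed by auto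
    then show ?thesis by blast
  qed
  have "\<exists>z\<in>X. \<xi> (0, x) = orb z x0" for x
    using normal[of "\<xi> (0, x)" x0] arr[of "(0, x)"] src[of "(0, x)"] x0 by simp
  then obtain f where f: "\<And>x. f x \<in> X" "\<And>x. \<xi> (0, x) = orb (f x) x0" by metis
  have key: "\<xi> (y mod ?N, x - y) = orb (f x) (f y)" for x y
  proof -
    have A: "(y mod ?N, x - y) \<in> Arr (gcyc n)" "(0, y) \<in> Arr (gcyc n)" using residue_le by auto
    have "Src ?G (\<xi> (y mod ?N, x - y)) = \<xi> (y mod ?N, 0)" using src[OF A(1)] by simp
    also have "\<dots> = orb (f y) (f y)" using rng[OF A(2)] f orbit_rng by simp
    finally obtain z where z: "z \<in> X" "\<xi> (y mod ?N, x - y) = orb z (f y)"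
      using normal[OF arr[OF A(1)]] f by blast
    \<comment> \<open>The arrow \<open>(0, x)\<close> factors as \<open>(y mod ?N, x - y)\<close>
      after \<open>(0, y)\<close>; comparing first coordinates over the common point
      \<open>x0\<close> gives \<open>z = f x\<close>.\<close>
    have "orb (f x) x0 = \<xi> (Mul (gcyc n) (y mod ?N, x - y) (0, y))" using f by simp
    also have "\<dots> = Mul ?G (\<xi> (y mod ?N, x - y)) (\<xi> (0, y))" using mul[OF A] by simp
    also have "\<dots> = orb z x0" using z f orbit_mul x0 by simp
    finally show ?thesis using z f x0 orb_cancel_right[of "f x" z x0] by simp
  qed
  have mono: "mono f"
  proof (rule monoI)
    fix y x :: int assume "y \<le> x"
    then have "\<xi> (y mod ?N, x - y) \<in> Pos ?G" using residue_le by (intro pos) simp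
    then show "f y \<le> f x" using key orbit_pos_iff f by simp
  qed
  \<comment> \<open>The integers \<open>?N\<close> and \<open>0\<close> represent the same unit, so
    \<open>f ?N\<close> lies in the orbit of \<open>x0\<close>; this produces
    \<open>h\<close>.\<close>
  have "\<xi> (?N mod ?N, 0) = orb (f ?N) (f ?N)" using key[of ?N ?N] by simp
  then obtain h where h: "h \<in> H" "f ?N = act h x0" using x0 orb_eqD[of "f ?N" "f ?N" x0 x0] f by auto
  have per: "f (x + int n + 1) = act h (f x)" for x
  proof -
    have "orb (f (x + ?N)) (f ?N) = orb (f x) x0" using key[of ?N "x + ?N"] f by simp
    then obtain k where k: "k \<in> H" "f (x + ?N) = act k (f x)" "f ?N = act k x0"
      using orb_eqD[of "f (x + ?N)" "f ?N" "f x" x0] f by auto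
    \<comment> \<open>The translating element could a priori depend on \<open>x\<close>; its effect
      on \<open>x0\<close> pins it down.\<close>
    then have "k = h" using act_eq[OF k(1) h(1) x0(1)] k(3) h(2) by simp
    then show ?thesis using k(2) by (simp add: add.assoc)
  qed
  have f0: "f 0 = x0" using f(2)[of 0] x0 f(1) orb_cancel_right[of "f 0" x0 x0] by simp
  \<comment> \<open>If \<open>h\<close> were not positive, monotonicity would force
    \<open>h = 0\<close>. A monotone map with period \<open>?N\<close> is constant, and then \<xi>
    would send everything to units.\<close>
  have hpos: "h > 0"
  proof (rule ccontr)
    assume "\<not> h > 0"
    then have "f ?N \<le> f 0" using act_mono_left[OF h(1) H_zero x0(1)] act_zero x0 h f0 by simp
    moreover have "f 0 \<le> f ?N" using mono by (simp add: mono_def)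
    ultimately have "act h x0 = act 0 x0" using h f0 act_zero x0 by simp
    then have "h = 0" using act_eq h H_zero x0 by blast
    then have period: "f (x + ?N) = f x" for x using per[of x] act_zero f by (simp add: add.assoc)
    have multiple: "f (x + int t * ?N) = f x" for x t
    proof (induction t)
      case (Suc t)
      have "x + int (Suc t) * ?N = (x + int t * ?N) + ?N" by (simp add: algebra_simps)
      then show ?case using period[of "x + int t * ?N"] Suc by metis
    qed simp
    have const: "f y = f x" if "x \<le> y" for x y
    proof (rule antisym)
      \<comment> \<open>Since \<open>?N\<close> is at least 1, going up \<open>y - x\<close> whole
        periods from \<open>x\<close> reaches \<open>y\<close> or passes it.\<close>
      have "(y - x) * 1 \<le> (y - x) * ?N" using that by (intro mult_left_mono) auto
      then have "y \<le> x + int (nat (y - x)) * ?N" using that by simp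
      then show "f y \<le> f x" using monoD[OF mono] multiple by metis
      show "f x \<le> f y" using monoD[OF mono that] .
    qed
    have "\<xi> (a, k) \<in> Units ?G" if "0 \<le> a" "a \<le> int n" for a k
    proof -
      have "\<xi> (a, k) = orb (f (a + k)) (f a)" using key[of a "a + k"] that by simp
      moreover have "f (a + k) = f a" using const[of a "a + k"] const[of "a + k" a] by (cases "0 \<le> k") simp_all
      ultimately show ?thesis using f unfolding unit_eq by auto
    qed
    then have "\<forall>p\<in>Arr (gcyc n). \<xi> p \<in> Units ?G" by auto
    then show False using nt by blast
  qed
  have lift: "is_lift n h f" unfolding is_lift_def using h hpos mono f per by auto
  have "\<xi> p = lift_mor n f p" for p
  proof (cases "p \<in> Arr (gcyc n)")
    case True
    then obtain a k where "p = (a, k)" "0 \<le> a" "a \<le> int n" by (cases p) auto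
    then show ?thesis using key[of a "a + k"] by (simp add: lift_mor_in)
  next
    case False
    moreover have "\<xi> \<in> extensional (Arr (gcyc n))" using mor by (simp add: og_morphism_def PiE_def)
    ultimately show ?thesis by (cases p) (simp add: lift_mor_def extensional_def del: gcyc_simps)
  qed
  then show thesis using that lift by blast
qed

text \<open>Uniqueness of lifts up to translation by \<open>H\<close>: each \<open>x\<close> yields
  its own translating element, but all of them carry \<open>g 0\<close> to \<open>f 0\<close> and so
  agree by freeness.\<close>

lemma lift_mor_eqD:
  assumes "is_lift n h f" "is_lift n h' g" "lift_mor n f = lift_mor n g"
  obtains k where "k \<in> H" "\<And>x. f x = act k (g x)"
proof -
  note X = is_liftD(4)[OF assms(1)] is_liftD(4)[OF assms(2)]
  have "orb (f x) (f 0) = orb (g x) (g 0)" for x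
    using assms(3) lift_mor_in[of 0 n f x] lift_mor_in[of 0 n g x] by simp
  then have *: "\<exists>k\<in>H. f x = act k (g x) \<and> f 0 = act k (g 0)" for x
    using orb_eqD[OF _ X(1) X(1)] by blast
  obtain k where k: "k \<in> H" "f 0 = act k (g 0)" using *[of 0] by blast
  have "f x = act k (g x)" for x
  proof -
    obtain l where l: "l \<in> H" "f x = act l (g x)" "f 0 = act l (g 0)" using *[of x] by blast
    have "l = k" by (rule act_eq[OF l(1) k(1) X(2) trans[OF l(3)[symmetric] k(2)]])
    then show ?thesis using l(2) by simp
  qed
  then show thesis by (rule that[OF k(1)])
qed

section \<open>Epicyclic morphisms acting on lifts, and functoriality\<close>

lemma is_lift_comp:
  assumes "is_lift m h f" "epi_map n m g"
  obtains h' where "is_lift n h' (f \<circ> g)"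
proof -
  obtain k where k: "k > 0" "\<And>x. g (x + int n + 1) = g x + k * (int m + 1)"
    using assms(2) by (auto simp: epi_map_def)
  have "is_lift n (of_int k * h) (f \<circ> g)"
    unfolding is_lift_def
    using k lift_shift[OF assms(1)] is_liftD[OF assms(1)] act_of_int_closed assms(2)
    by (auto simp: epi_map_def mono_def)
  then show thesis by (rule that)
qed

text \<open>This reduces all statements about \<open>F_mor\<close> to precomposition of maps on the
  integers, with any representative \<open>g\<close> of the class.\<close>

lemma F_mor_lift_mor:
  assumes "is_lift m h f" "\<phi> \<in> Hom epicyclic n m" "g \<in> \<phi>"
  shows "F_mor m n \<phi> (lift_mor m f) = lift_mor n (f \<circ> g)"
proof
  fix p
  show "F_mor m n \<phi> (lift_mor m f) p = lift_mor n (f \<circ> g) p"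
  proof (cases "p \<in> Arr (gcyc n)")
    case True
    then obtain a k where p: "p = (a, k)" "0 \<le> a" "a \<le> int n" by (cases p) auto
    then have "epi_act n m \<phi> p = (g a mod (int m + 1), g (a + k) - g a)"
      using epi_act_eq[OF assms(2,3), of a "a + k"] by simp
    then show ?thesis using True p lift_mor_eq[OF assms(1)] by (simp add: F_mor_def compose_def lift_mor_in)
  qed (simp add: F_mor_def compose_def lift_mor_def del: gcyc_simps)
qed

lemma set_functor_F: "set_functor (op_cat epicyclic) (F_obj (GXH X H act)) F_mor"
proof (intro set_functor.intro category_op_cat category_epicyclic set_functor_axioms.intro, goal_cases)
  case (1 c d \<phi> \<xi>)
  then have "\<phi> \<in> Hom epicyclic d c" by (simp add: op_cat_def)
  moreover from this obtain g where g: "epi_map d c g" "g \<in> \<phi>" by (rule Hom_epicyclicE)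
  moreover obtain f h where f: "is_lift c h f" "\<xi> = lift_mor c f" using 1(4) by (rule F_obj_lift)
  moreover obtain h' where "is_lift d h' (f \<circ> g)" using f(1) g(1) by (rule is_lift_comp)
  ultimately show ?case using F_mor_lift_mor lift_mor_F_obj by metis
next
  case (2 c \<xi>)
  have "Id (op_cat epicyclic) c \<in> Hom epicyclic c c"
    using category.id_in[OF category_epicyclic] by (simp add: op_cat_def epicyclic_def)
  moreover have "id \<in> Id (op_cat epicyclic) c"
    using shift_class_self by (simp add: op_cat_def epicyclic_def)
  moreover obtain f h where "is_lift c h f" "\<xi> = lift_mor c f" using 2(2) by (rule F_obj_lift)
  ultimately show ?case using F_mor_lift_mor[of c h f _ c id] by simp
next
  case (3 c d e \<phi> \<psi> \<xi>)
  then have \<phi>: "\<phi> \<in> Hom epicyclic d c" and \<psi>: "\<psi> \<in> Hom epicyclic e d" by (simp_all add: op_cat_def)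
  obtain g where g: "epi_map d c g" "\<phi> = shift_rel c `` {g}" "g \<in> \<phi>" using \<phi> by (rule Hom_epicyclicE)
  obtain u where u: "epi_map e d u" "\<psi> = shift_rel d `` {u}" "u \<in> \<psi>" using \<psi> by (rule Hom_epicyclicE)
  obtain f h where f: "is_lift c h f" "\<xi> = lift_mor c f" using 3(6) by (rule F_obj_lift)
  obtain h' where h': "is_lift d h' (f \<circ> g)" using f(1) g(1) by (rule is_lift_comp)
  have comp: "Comp (op_cat epicyclic) \<psi> \<phi> = shift_rel c `` {g \<circ> u}"
    unfolding g(2) u(2) using comp_class[OF g(1)] by (simp add: op_cat_def)
  have "shift_rel c `` {g \<circ> u} \<in> Hom epicyclic e c"
    unfolding Hom_epicyclic_iff using epi_map_comp[OF u(1) g(1)] by blast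
  then show ?case
    unfolding comp f(2)
    using F_mor_lift_mor[OF f(1) _ shift_class_self] F_mor_lift_mor[OF f(1) \<phi> g(3)]
      F_mor_lift_mor[OF h' \<psi> u(3)] by (simp add: comp_assoc)
qed

end


section \<open>Enumerating finitely generated invariant subsets\<close>

locale archimedean_rat_order_action = free_rat_order_action +
  assumes cofinal: "\<lbrakk>x \<in> X; y \<in> X\<rbrakk> \<Longrightarrow> \<exists>h\<in>H. act h x > y"
begin

text \<open>Cofinality of \<open>H\<close> passes to the multiples of one \<open>h > 0\<close>
  because the rationals are archimedean: \<open>l\<close> is at most \<open>h\<close> times the
  ceiling of \<open>l / h\<close>.\<close>

lemma cofinal_multiple:
  assumes "h \<in> H" "h > 0" "x \<in> X" "y \<in> X"
  obtains k :: int where "act (of_int k * h) x > y"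
proof -
  obtain l where l: "l \<in> H" "act l x > y" using cofinal assms by blast
  have "l \<le> of_int \<lceil>l / h\<rceil> * h" using assms(2) by (simp add: pos_divide_le_eq[symmetric])
  then have "act l x \<le> act (of_int \<lceil>l / h\<rceil> * h) x"
    using act_mono_left act_of_int_closed l assms by simp
  with l(2) have "act (of_int \<lceil>l / h\<rceil> * h) x > y" by simp
  then show thesis by (rule that)
qed

section \<open>Translations by multiples of a fixed positive element\<close>

context
  fixes h
  assumes h: "h \<in> H" "h > 0"
begin

definition translate :: "int \<Rightarrow> 'a \<Rightarrow> 'a" where
  "translate k = act (of_int k * h)"

lemma translate_1: "translate 1 = act h"
  by (simp add: translate_def)

lemma translate_closed: "x \<in> X \<Longrightarrow> translate k x \<in> X"
  unfolding translate_def using act_closed act_of_int_closed h by simp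

lemma translate_add: "x \<in> X \<Longrightarrow> translate (k + l) x = translate k (translate l x)"
  unfolding translate_def using act_add act_of_int_closed h by (simp add: distrib_right)

lemma translate_mono_left: "x \<in> X \<Longrightarrow> k \<le> l \<Longrightarrow> translate k x \<le> translate l x"
  unfolding translate_def using act_mono_left act_of_int_closed h by (simp add: mult_right_mono)

lemma translate_less: "x \<in> X \<Longrightarrow> y \<in> X \<Longrightarrow> x < y \<Longrightarrow> translate k x < translate k y"
  unfolding translate_def using act_less act_of_int_closed h by simp

lemma translate_le: "x \<in> X \<Longrightarrow> y \<in> X \<Longrightarrow> x \<le> y \<Longrightarrow> translate k x \<le> translate k y"
  unfolding translate_def using act_le act_of_int_closed h by simp

text \<open>The half-open interval from \<open>s\<close> to \<open>act h s\<close> meets every orbit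
  of the multiples of \<open>h\<close>: the first translate of \<open>x\<close> that is not below
  \<open>s\<close> lies in it.\<close>

lemma fundamental_domain:
  assumes "x \<in> X" "s \<in> X"
  shows "\<exists>k::int. s \<le> translate k x \<and> translate k x < translate 1 s"
proof -
  obtain k where k: "s < translate k x" using cofinal_multiple[OF h assms] unfolding translate_def by blast
  obtain l where "x < translate l s" using cofinal_multiple[OF h assms(2,1)] unfolding translate_def by blast
  then have "translate (- l) x < translate (- l) (translate l s)"
    by (intro translate_less translate_closed assms)
  also have "\<dots> = s" using translate_add[of s "- l" l] assms act_zero by (simp add: translate_def)
  finally have l: "\<not> s \<le> translate (int 0 - l) x" by simp
  have "translate k x \<le> translate (int (nat (k + l)) - l) x"
    by (intro translate_mono_left assms) simp
  with k have "s \<le> translate (int (nat (k + l)) - l) x" by simp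
  \<comment> \<open>The offset \<open>- l\<close> starts the search below \<open>s\<close>, so a
    natural number can index the crossing and a failing predecessor exists.\<close>
  from ex_least_nat_less[of "\<lambda>j. s \<le> translate (int j - l) x", OF this] l
  obtain j where j: "\<not> s \<le> translate (int j - l) x" "s \<le> translate (int (Suc j) - l) x" by blast
  have "translate (int (Suc j) - l) x = translate 1 (translate (int j - l) x)"
    using translate_add[OF assms(1), of 1 "int j - l"] by (simp add: algebra_simps)
  also have "\<dots> < translate 1 s" using j(1)
    by (intro translate_less translate_closed assms) simp
  finally show ?thesis using j(2) by auto
qed

text \<open>Translate every point of \<open>S\<close> into the window from \<open>s\<close> to
  \<open>act h s\<close>, list the resulting finite set in increasing order, and repeat the list in
  each translated window.\<close>

lemma orbit_enumeration:
  assumes "finite S" "S \<noteq> {}" "S \<subseteq> X"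
  obtains p \<zeta> where "is_lift p h \<zeta>" "strict_mono \<zeta>"
    "\<forall>s\<in>S. \<forall>k. act (of_int k * h) s \<in> range \<zeta>"
proof -
  obtain s where s: "s \<in> S" using assms by blast
  have sX: "s \<in> X" using s assms by blast
  have "\<forall>x\<in>S. \<exists>k. s \<le> translate k x \<and> translate k x < translate 1 s"
    using fundamental_domain assms sX by blast
  then obtain c where c: "\<And>x. x \<in> S \<Longrightarrow> s \<le> translate (c x) x \<and> translate (c x) x < translate 1 s" by metis
  define L where "L = sorted_list_of_set ((\<lambda>x. translate (c x) x) ` S)"
  have L: "set L = (\<lambda>x. translate (c x) x) ` S" "sorted_wrt (<) L"
    unfolding L_def using assms(1) by simp_all
  \<comment> \<open>The object \<open>p\<close> has period \<open>p + 1\<close>, so the list of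
    window points must have length \<open>p + 1\<close>.\<close>
  define p where "p = length L - 1"
  have "L \<noteq> []" using L(1) s by auto
  then have p: "length L = Suc p" unfolding p_def by (cases L) auto
  define e where "e i = L ! nat i" for i
  have e: "e i \<in> X" "s \<le> e i" "e i < translate 1 s" if "0 \<le> i" "i < int p + 1" for i
  proof -
    have "e i \<in> set L" unfolding e_def using that p by (intro nth_mem) simp
    then show "e i \<in> X" "s \<le> e i" "e i < translate 1 s"
      unfolding L(1) using c assms(3) translate_closed by auto
  qed
  have e_less: "e i < e j" if "0 \<le> i" "i < j" "j < int p + 1" for i j
    unfolding e_def using that p by (intro sorted_wrt_nth_less[OF L(2)]) auto
  \<comment> \<open>The quotient selects the window and the remainder selects the point in
    it.\<close>
  define \<zeta> where "\<zeta> x = translate (x div (int p + 1)) (e (x mod (int p + 1)))" for x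
  have em: "e (x mod (int p + 1)) \<in> X" "s \<le> e (x mod (int p + 1))"
    "e (x mod (int p + 1)) < translate 1 s" for x
    by (intro e pos_mod_sign pos_mod_bound; simp)+
  have strict: "strict_mono \<zeta>"
  proof (rule strict_monoI)
    fix x y :: int assume "x < y"
    then have "x div (int p + 1) \<le> y div (int p + 1)" by (intro zdiv_mono1) auto
    then consider "x div (int p + 1) = y div (int p + 1)" | "x div (int p + 1) + 1 \<le> y div (int p + 1)"
      by linarith
    then show "\<zeta> x < \<zeta> y"
    proof cases
      case 1
      then have "x mod (int p + 1) < y mod (int p + 1)"
        using \<open>x < y\<close> div_mult_mod_eq[of x "int p + 1"] div_mult_mod_eq[of y "int p + 1"] by simp
      then show ?thesis unfolding \<zeta>_def 1
        by (intro translate_less e_less em pos_mod_sign pos_mod_bound) simp_all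
    next
      case 2
      \<comment> \<open>For different windows, the left end of the window of \<open>y\<close>
        separates the two values.\<close>
      have "\<zeta> x < translate (x div (int p + 1)) (translate 1 s)"
        unfolding \<zeta>_def by (intro translate_less translate_closed em sX)
      also have "\<dots> = translate (x div (int p + 1) + 1) s" using translate_add[OF sX] by simp
      also have "\<dots> \<le> translate (y div (int p + 1)) s" by (intro translate_mono_left sX 2)
      also have "\<dots> \<le> \<zeta> y" unfolding \<zeta>_def by (intro translate_le em sX)
      finally show ?thesis .
    qed
  qed
  have lift: "is_lift p h \<zeta>"
    unfolding is_lift_def
  proof (intro conjI allI)
    show "mono \<zeta>" using strict by (rule strict_mono_mono)
    show "range \<zeta> \<subseteq> X" unfolding \<zeta>_def using translate_closed em by blast
    fix x
    have "(x + (int p + 1)) div (int p + 1) = 1 + x div (int p + 1)" by simp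
    then have "\<zeta> (x + (int p + 1)) = act h (\<zeta> x)" unfolding \<zeta>_def
      using translate_add[OF em(1), of 1] translate_1 by (simp add: add.commute[of 1])
    then show "\<zeta> (x + int p + 1) = act h (\<zeta> x)" by (simp add: add.assoc)
  qed (use h in auto)
  have mem: "translate k x \<in> range \<zeta>" if x: "x \<in> S" for x k
  proof -
    have "translate (c x) x \<in> set L" using L x by blast
    then obtain i where i: "i < Suc p" "translate (c x) x = L ! i" using p by (metis in_set_conv_nth)
    \<comment> \<open>The point \<open>x\<close> was moved by \<open>c x\<close> into the base
      window, so \<open>translate k x\<close> sits in window number \<open>k - c x\<close>.\<close>
    have "((k - c x) * (int p + 1) + int i) div (int p + 1) = k - c x"
      using i by simp
    moreover have "((k - c x) * (int p + 1) + int i) mod (int p + 1) = int i" using i by simp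
    ultimately have "\<zeta> ((k - c x) * (int p + 1) + int i) = translate (k - c x) (translate (c x) x)"
      unfolding \<zeta>_def using i by (simp add: e_def)
    also have "\<dots> = translate k x" using translate_add[of x "k - c x" "c x"] x assms by auto
    finally show ?thesis unfolding translate_def by (metis rangeI)
  qed
  show thesis by (rule that[OF lift strict]) (use mem in \<open>simp add: translate_def\<close>)
qed

end

section \<open>Factoring lifts through an enumeration; common divisors in \<open>H\<close>\<close>

lemma range_lift_subset:
  assumes "is_lift n (of_int a * g) f" "f ` {0..int n} \<subseteq> S"
    and "\<forall>s\<in>S. \<forall>k. act (of_int k * g) s \<in> R"
  shows "range f \<subseteq> R"
proof clarify
  fix x
  have "f (x mod (int n + 1)) \<in> S" using assms(2) residue_le[of x n] by auto
  then have "act (of_int (x div (int n + 1) * a) * g) (f (x mod (int n + 1))) \<in> R"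
    using assms(3) by blast
  then show "f x \<in> R" using lift_mod[OF assms(1), of x] by (simp add: mult.assoc)
qed

text \<open>Injectivity of \<zeta> forces \<open>u\<close>, and order reflection makes it monotone.
  Translation by \<open>a * g\<close> on values is a shift by \<open>a * (p + 1)\<close> on indices,
  and \<open>a > 0\<close> since both steps are positive.\<close>

lemma lift_factor:
  assumes "is_lift p g \<zeta>" "strict_mono \<zeta>" "g > 0" "is_lift n (of_int a * g) f" "range f \<subseteq> range \<zeta>"
  obtains u where "epi_map n p u" "f = \<zeta> \<circ> u"
proof -
  have "\<forall>x. \<exists>y. f x = \<zeta> y" using assms(5) by blast
  then obtain u where u: "\<And>x. f x = \<zeta> (u x)" by metis
  have "0 < of_int a * g" using is_liftD(2)[OF assms(4)] .
  then have "a > 0" using assms(3) by (simp add: zero_less_mult_iff)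
  moreover have "mono u"
    using is_liftD(3)[OF assms(4)] strict_mono_less_eq[OF assms(2)] by (simp add: mono_def u)
  moreover have "u (x + int n + 1) = u x + a * (int p + 1)" for x
  proof -
    have "\<zeta> (u (x + int n + 1)) = \<zeta> (u x + a * (int p + 1))"
      using is_liftD(5)[OF assms(4), of x] lift_shift[OF assms(1)] by (simp add: u)
    then show ?thesis using strict_mono_eq[OF assms(2)] by simp
  qed
  ultimately have "epi_map n p u" unfolding epi_map_def by blast
  then show thesis using that u by (simp add: fun_eq_iff)
qed

text \<open>Over a common denominator the gcd of the numerators works; Bezout's identity places it
  in \<open>H\<close>. It is positive because \<open>h > 0\<close>, whatever the sign of
  \<open>k\<close>.\<close>

lemma common_divisor:
  assumes "h \<in> H" "k \<in> H" "h > 0"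
  obtains g a b where "g \<in> H" "g > 0" "h = of_int a * g" "k = of_int b * g"
proof -
  obtain h1 h2 where h: "quotient_of h = (h1, h2)" by force
  obtain k1 k2 where k: "quotient_of k = (k1, k2)" by force
  have pos: "h2 > 0" "k2 > 0" using quotient_of_denom_pos h k by auto
  define d where "d = h2 * k2"
  define m l where "m = h1 * k2" and "l = k1 * h2"
  have d: "d > 0" "h = of_int m / of_int d" "k = of_int l / of_int d"
    using quotient_of_div[OF h] quotient_of_div[OF k] pos by (auto simp: d_def m_def l_def)
  have "m \<noteq> 0" using d assms(3) by auto
  define g :: rat where "g = of_int (gcd m l) / of_int d"
  obtain u v where "u * m + v * l = gcd m l" using bezout_int by blast
  then have "g = of_int u * h + of_int v * k"
    unfolding g_def d(2,3) by (simp flip: of_int_mult of_int_add add_divide_distrib)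
  then have "g \<in> H" using H_add act_of_int_closed assms by simp
  moreover have "g > 0" unfolding g_def using d(1) \<open>m \<noteq> 0\<close> by simp
  moreover have "h = of_int (m div gcd m l) * g" "k = of_int (l div gcd m l) * g"
    unfolding g_def d(2,3) by (simp_all flip: of_int_mult)
  ultimately show thesis by (rule that)
qed

section \<open>The filtering conditions and flatness\<close>

lemma filtering_F:
  assumes "h0 \<in> H" "h0 > 0" "x0 \<in> X"
  shows "filtering (elements_cat (op_cat epicyclic) (F_obj (GXH X H act)) F_mor)"
    (is "filtering ?E")
proof -
  have Ob: "(n, lift_mor n f) \<in> Ob ?E" if "is_lift n h f" for n h f
    using lift_mor_F_obj[OF that] by (simp add: elements_cat_def op_cat_def epicyclic_def)
  have ObE: "\<exists>n h f. is_lift n h f \<and> i = (n, lift_mor n f)" if "i \<in> Ob ?E" for i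
  proof -
    obtain n \<xi> where i: "i = (n, \<xi>)" by force
    then have "\<xi> \<in> F_obj (GXH X H act) n" using that by (simp add: elements_cat_def)
    then show ?thesis using i by (elim F_obj_lift) blast
  qed
  have HomE: "Hom ?E (p, \<zeta>) (n, \<xi>) = {\<phi> \<in> Hom epicyclic n p. F_mor p n \<phi> \<zeta> = \<xi>}" for p n \<zeta> \<xi>
    by (simp add: elements_cat_def op_cat_def)
  have hom: "shift_rel p `` {u} \<in> Hom ?E (p, lift_mor p \<zeta>) (n, lift_mor n (\<zeta> \<circ> u))"
    if "is_lift p h \<zeta>" "epi_map n p u" for p h \<zeta> n u
  proof -
    have "shift_rel p `` {u} \<in> Hom epicyclic n p" using that(2) Hom_epicyclic_iff by blast
    then show ?thesis using F_mor_lift_mor[OF that(1) _ shift_class_self] by (simp add: HomE)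
  qed
  \<comment> \<open>Passing to the opposite category reverses composition: equalizing by \<gamma>
    here means composing with \<gamma> on the left in \<open>epicyclic\<close>.\<close>
  have Comp: "Comp ?E \<alpha> \<gamma> = Comp epicyclic \<gamma> \<alpha>" for \<alpha> \<gamma> by (simp add: elements_cat_def op_cat_def)
  show ?thesis
    unfolding filtering_def
  proof (intro conjI ballI)
    obtain p \<zeta> where "is_lift p h0 \<zeta>"
      by (rule orbit_enumeration[of h0 "{x0}"]) (use assms in auto)
    then show "Ob ?E \<noteq> {}" using Ob by blast
  next
    fix i j assume "i \<in> Ob ?E" "j \<in> Ob ?E"
    then obtain n h f m k g where f: "is_lift n h f" "i = (n, lift_mor n f)"
      and g: "is_lift m k g" "j = (m, lift_mor m g)" using ObE by metis
    obtain c a b where c: "c \<in> H" "c > 0" "h = of_int a * c" "k = of_int b * c"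
      using common_divisor[of h k] is_liftD[OF f(1)] is_liftD[OF g(1)] by blast
    \<comment> \<open>One period of each lift suffices: both steps are multiples of
      \<open>c\<close>, so an enumeration of the \<open>c\<close>-translates of \<open>?S\<close>
      contains both ranges, and \<open>f\<close> and \<open>g\<close> factor through it.\<close>
    let ?S = "f ` {0..int n} \<union> g ` {0..int m}"
    have S: "finite ?S" "?S \<noteq> {}" "?S \<subseteq> X" using is_liftD(4)[OF f(1)] is_liftD(4)[OF g(1)] by auto
    obtain p \<zeta> where \<zeta>: "is_lift p c \<zeta>" "strict_mono \<zeta>"
      "\<forall>s\<in>?S. \<forall>k. act (of_int k * c) s \<in> range \<zeta>"
      by (rule orbit_enumeration[OF c(1,2) S])
    have "range f \<subseteq> range \<zeta>" by (rule range_lift_subset[OF f(1)[unfolded c] _ \<zeta>(3)]) auto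
    then obtain u where u: "epi_map n p u" "f = \<zeta> \<circ> u"
      using lift_factor[OF \<zeta>(1,2) c(2) f(1)[unfolded c]] by blast
    have "range g \<subseteq> range \<zeta>" by (rule range_lift_subset[OF g(1)[unfolded c] _ \<zeta>(3)]) auto
    then obtain v where v: "epi_map m p v" "g = \<zeta> \<circ> v"
      using lift_factor[OF \<zeta>(1,2) c(2) g(1)[unfolded c]] by blast
    show "\<exists>k\<in>Ob ?E. Hom ?E k i \<noteq> {} \<and> Hom ?E k j \<noteq> {}"
      using Ob[OF \<zeta>(1)] hom[OF \<zeta>(1) u(1)] hom[OF \<zeta>(1) v(1)] unfolding f(2) g(2) u(2) v(2) by blast
  next
    fix i j \<alpha> \<beta>
    assume ij: "i \<in> Ob ?E" "j \<in> Ob ?E" and "\<alpha> \<in> Hom ?E i j" "\<beta> \<in> Hom ?E i j"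
    moreover obtain n h f where f: "is_lift n h f" "i = (n, lift_mor n f)" using ObE ij by metis
    moreover obtain m \<eta> where "j = (m, \<eta>)" by force
    ultimately have \<alpha>: "\<alpha> \<in> Hom epicyclic m n" and \<beta>: "\<beta> \<in> Hom epicyclic m n"
      and eq: "F_mor n m \<alpha> (lift_mor n f) = F_mor n m \<beta> (lift_mor n f)" by (simp_all add: HomE)
    obtain s where s: "epi_map m n s" "\<alpha> = shift_rel n `` {s}" "s \<in> \<alpha>" using \<alpha> by (rule Hom_epicyclicE)
    obtain t where t: "epi_map m n t" "\<beta> = shift_rel n `` {t}" "t \<in> \<beta>" using \<beta> by (rule Hom_epicyclicE)
    obtain h1 where h1: "is_lift m h1 (f \<circ> s)" using f(1) s(1) by (rule is_lift_comp)
    obtain h2 where h2: "is_lift m h2 (f \<circ> t)" using f(1) t(1) by (rule is_lift_comp)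
    have "lift_mor m (f \<circ> s) = lift_mor m (f \<circ> t)"
      using eq F_mor_lift_mor[OF f(1) \<alpha> s(3)] F_mor_lift_mor[OF f(1) \<beta> t(3)] by simp
    then obtain k where k: "k \<in> H" "\<And>x. f (s x) = act k (f (t x))"
      using lift_mor_eqD[OF h1 h2] by (metis comp_apply)
    \<comment> \<open>The element \<open>k\<close> need not be a multiple of \<open>h\<close>;
      dividing both by \<open>c\<close> makes translation by \<open>k\<close> an integer shift of
      the finer enumeration.\<close>
    obtain c a b where c: "c \<in> H" "c > 0" "h = of_int a * c" "k = of_int b * c"
      using common_divisor[of h k] is_liftD[OF f(1)] k(1) by blast
    have S: "finite (f ` {0..int n})" "f ` {0..int n} \<noteq> {}" "f ` {0..int n} \<subseteq> X"
      using is_liftD(4)[OF f(1)] by auto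
    obtain p \<zeta> where \<zeta>: "is_lift p c \<zeta>" "strict_mono \<zeta>"
      "\<forall>s\<in>f ` {0..int n}. \<forall>k. act (of_int k * c) s \<in> range \<zeta>"
      by (rule orbit_enumeration[OF c(1,2) S])
    have "range f \<subseteq> range \<zeta>" by (rule range_lift_subset[OF f(1)[unfolded c] _ \<zeta>(3)]) auto
    then obtain u where u: "epi_map n p u" "f = \<zeta> \<circ> u"
      using lift_factor[OF \<zeta>(1,2) c(2) f(1)[unfolded c]] by blast
    \<comment> \<open>Read through \<zeta>, translation by \<open>k = b * c\<close> is a shift by
      \<open>b * (p + 1)\<close>, which the shift relation identifies with the identity.\<close>
    have "(u \<circ> s) x = (u \<circ> t) x + b * (int p + 1)" for x
    proof -
      have "\<zeta> (u (s x)) = \<zeta> (u (t x) + b * (int p + 1))"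
        using k(2)[of x] lift_shift[OF \<zeta>(1)] by (simp add: u(2) c(4))
      then show ?thesis using strict_mono_eq[OF \<zeta>(2)] by simp
    qed
    then have "shift_rel p `` {u \<circ> s} = shift_rel p `` {u \<circ> t}"
      using shift_class_eqI[of "u \<circ> s" "u \<circ> t" b p] by simp
    then have "Comp ?E \<alpha> (shift_rel p `` {u}) = Comp ?E \<beta> (shift_rel p `` {u})"
      unfolding Comp s(2) t(2) comp_class[OF u(1)] .
    then show "\<exists>k\<in>Ob ?E. \<exists>\<gamma>\<in>Hom ?E k i. Comp ?E \<alpha> \<gamma> = Comp ?E \<beta> \<gamma>"
      using Ob[OF \<zeta>(1)] hom[OF \<zeta>(1) u(1)] unfolding f(2) u(2) by blast
  qed
qed

end

theorem proposition3p3: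
  fixes H :: "rat set" and X :: "'x::linorder set" and act :: "rat \<Rightarrow> 'x \<Rightarrow> 'x"
  assumes "rat_order_action H X act"
    and "H \<noteq> {0}"
    and "X \<noteq> {}"
    and "\<And>h x. \<lbrakk>h \<in> H; h \<ge> 0; h \<noteq> 0; x \<in> X\<rbrakk> \<Longrightarrow> act h x > x"
    and "\<And>x y. \<lbrakk>x \<in> X; y \<in> X\<rbrakk> \<Longrightarrow> \<exists>h\<in>H. h \<ge> 0 \<and> act h x > y"
  shows "flat_functor (op_cat epicyclic) (F_obj (GXH X H act)) F_mor"
proof -
  interpret rat_order_action H X act by fact
  interpret archimedean_rat_order_action H X act
  proof unfold_locales
    show "act h x > x" if "h \<in> H" "h > 0" "x \<in> X" for h x using assms(4) that by simp
    show "\<exists>h\<in>H. act h x > y" if "x \<in> X" "y \<in> X" for x y using assms(5)[OF that] by blast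
  qed
  obtain h where "h \<in> H" "h \<noteq> 0" using assms(2) H_zero by blast
  \<comment> \<open>A subgroup contains the absolute values of its elements, so a positive element
    is available.\<close>
  then have "\<bar>h\<bar> \<in> H" "\<bar>h\<bar> > 0" using H_uminus by (auto simp: abs_if)
  moreover obtain x where "x \<in> X" using assms(3) by blast
  ultimately show ?thesis unfolding flat_functor_def by (intro conjI set_functor_F filtering_F)
qed

end
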